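(* Let $n\ge 2$ and let $\boldsymbol{\pi}\in\mathcal{L}^n$. Then the convex hull $\operatorname{conv}(\mathcal{S}^{\boldsymbol{\pi}})$ is an $(n-1)$-dimensional simplex in $\mathbb{R}^n$.
   Context: Stack-sorting: for a finite sequence $\boldsymbol{\pi}=\pi_1\pi_2\cdots\pi_n$ of distinct elements of a totally ordered set, the output $s(\boldsymbol{\pi})$ is obtained as follows. Start with an empty stack (last-in, first-out) and an empty output. For $i=1,\dots,n$ in order: while the stack is nonempty and $\pi_i$ is greater than the top element of the stack, pop the top element and append it to the end of the output; then push $\pi_i$ onto the stack. After all entries have been pushed, pop all remaining elements from top to bottom, appending each to the output. Write $s^0(\boldsymbol{\pi})=\boldsymbol{\pi}$ and $s^{i}(\boldsymbol{\pi})=s(s^{i-1}(\boldsymbol{\pi}))$. For a permutation $\boldsymbol{\pi}$ of $\{1,\dots,n\}$, iterating $s$ eventually reaches the identity $12\cdots n$ (fixed by $s$), and $\mathcal{S}^{\boldsymbol{\pi}}:=\{s^0(\boldsymbol{\pi}),s^1(\boldsymbol{\pi}),s^2(\boldsymbol{\pi}),\dots\}$ is the finite set of all iterates until the identity is reached. $\mathcal{L}^n$ is the set of permutations of $\{1,\dots,n\}$ (in one-line notation) of the form $Ln1$, where $L$ is a permutation of $\{2,3,\dots,n-1\}$; i.e. the last two entries are $n$ and then $1$. A permutation $\pi_1\cdots\pi_n$ is identified with the point $(\pi_1,\dots,\pi_n)\in\mathbb{R}^n$. An $m$-dimensional simplex is the convex hull of $m+1$ affinely independent points. *)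

theory Defs
  imports "HOL-Analysis.Analysis" "HOL-Combinatorics.Multiset_Permutations"
begin

text \<open>
  One run of the stack-sorting machine. The arguments are the remaining input, the stack (its top
  is the head of the list), and the output produced so far.
\<close>

fun stack_run :: "'a::linorder list \<Rightarrow> 'a list \<Rightarrow> 'a list \<Rightarrow> 'a list" where
  "stack_run [] st out = out @ st"
| "stack_run (x # xs) [] out = stack_run xs [x] out"
| "stack_run (x # xs) (t # st) out =
     (if t < x then stack_run (x # xs) st (out @ [t]) else stack_run xs (x # t # st) out)"

definition stack_sort :: "'a::linorder list \<Rightarrow> 'a list" where
  "stack_sort p = stack_run p [] []"

definition stack_iterates :: "'a::linorder list \<Rightarrow> 'a list set" where
  "stack_iterates p = {(stack_sort ^^ k) p | k. True}"

definition Ln1_perms :: "nat \<Rightarrow> nat list set" where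
  "Ln1_perms n = {L @ [n, 1] | L. L \<in> permutations_of_set {2..n - 1}}"

text \<open>
  The space \<open>real ^ 'n\<close> has coordinates indexed by the type \<open>'n\<close>, which need not be ordered.
  The map \<open>idx\<close> gives the (zero-based) position of each coordinate; it is meant to be a bijection
  from \<open>'n\<close> onto \<open>{0..<n}\<close>, where \<open>n\<close> is the length of the list.
\<close>

definition perm_point :: "('n::finite \<Rightarrow> nat) \<Rightarrow> nat list \<Rightarrow> real ^ 'n" where
  "perm_point idx p = (\<chi> i. real (p ! idx i))"

end

theory Submission
  imports Defs
begin

text \<open>
  Sorting a permutation of the form \<open>L n 1\<close> fixes one more entry at its end in every pass. After
  the pass that leaves \<open>m+1, \<dots>, n\<close> in place, the word is \<open>B m 1 (m+1) \<dots> n\<close> for a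
  permutation \<open>B\<close> of \<open>{2, \<dots>, m-1}\<close>: in the next pass \<open>m\<close> empties the stack, \<open>1\<close> is put on top of
  it, and these two leave in the order \<open>1, m\<close>; thus the result is \<open>s(B) 1 m (m+1) \<dots> n\<close>. As the
  machine outputs the largest entry last, \<open>s(B)\<close> ends in \<open>m-1\<close> and the pattern persists, until after
  \<open>n - 1\<close> passes the entry \<open>1\<close> arrives at the front and the word is the identity. This is the lemma
  \<open>stack_sort_stage\<close>.

  The \<open>n\<close> iterates are therefore triangular with respect to the identity. The iterate
  \<open>B m 1 (m+1) \<dots> n\<close> has the entry \<open>1\<close> at position \<open>m\<close>, whereas all later iterates have the entry
  \<open>m\<close> there and so lie in the hyperplane \<open>x\<^sub>m = m\<close>. Adding the iterates from last to first, each new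
  point avoids the affine hull of the previous ones, which gives affine independence.
\<close>

section \<open>Stack-sorting and the largest entry\<close>

lemma mset_stack_run: "mset (stack_run xs st out) = mset xs + mset st + mset out"
  by (induction xs st out rule: stack_run.induct) auto

lemma mset_stack_sort [simp]: "mset (stack_sort xs) = mset xs"
  by (simp add: stack_sort_def mset_stack_run)

lemma set_stack_sort [simp]: "set (stack_sort xs) = set xs"
  by (metis mset_stack_sort set_mset_mset)

lemma distinct_stack_sort [simp]: "distinct (stack_sort xs) = distinct xs"
  by (metis mset_stack_sort mset_eq_imp_distinct_iff)

lemma stack_sort_Nil [simp]: "stack_sort [] = []"
  by (simp add: stack_sort_def)

text \<open>
  Appending to the output commutes with running the machine, since the output is never read.
\<close>

lemma stack_run_output: "stack_run xs st (out @ out') = out @ stack_run xs st out'"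
  by (induction xs st out' rule: stack_run.induct) (auto simp flip: append_assoc)

text \<open>
  An entry larger than everything before it empties the stack when it arrives, so that the machine
  has by then produced the same output as if the input had ended just before it.
\<close>

lemma stack_run_push_greater:
  assumes "\<forall>x \<in> set xs \<union> set st. x < m"
  shows "stack_run (xs @ m # ys) st out = stack_run ys [m] (stack_run xs st out)"
  using assms
proof (induction xs st out rule: stack_run.induct)
  case (1 st out)
  then show ?case
    by (induction st arbitrary: out) auto
qed auto

text \<open>
  An entry at the bottom of the stack that no later entry exceeds stays there until the end.
\<close>

lemma stack_run_bottom:
  assumes "\<forall>y \<in> set ys. y \<le> m"
  shows "stack_run ys (st @ [m]) out = stack_run ys st out @ [m]"
  using assms by (induction ys st out rule: stack_run.induct) auto

text \<open>
  The recursive description of stack-sorting: the largest entry separates the input into two parts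
  that do not interact, and is itself output last.
\<close>

lemma stack_sort_split_at_max:
  assumes "\<forall>x \<in> set xs. x < m" and "\<forall>y \<in> set ys. y \<le> m"
  shows "stack_sort (xs @ m # ys) = stack_sort xs @ stack_sort ys @ [m]"
proof -
  have "stack_sort (xs @ m # ys) = stack_run ys ([] @ [m]) (stack_sort xs)"
    using assms(1) by (simp add: stack_sort_def stack_run_push_greater)
  also have "\<dots> = stack_run ys [] (stack_sort xs @ []) @ [m]"
    using assms(2) by (subst stack_run_bottom) simp_all
  also have "\<dots> = stack_sort xs @ stack_sort ys @ [m]"
    by (subst stack_run_output) (simp add: stack_sort_def)
  finally show ?thesis .
qed

lemma last_stack_sort:
  assumes "distinct xs" and "xs \<noteq> []"
  shows "last (stack_sort xs) = Max (set xs)"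
proof -
  have "Max (set xs) \<in> set xs"
    using assms by simp
  then obtain ys zs where split: "xs = ys @ Max (set xs) # zs"
    by (meson split_list)
  moreover have "x < Max (set xs)" if "x \<in> set ys" for x
  proof -
    have "x \<noteq> Max (set xs)"
      using assms(1) that split by (metis distinct_append disjoint_iff list.set_intros(1))
    moreover have "x \<in> set xs"
      using that by (subst split) simp
    ultimately show ?thesis
      by (simp add: le_neq_trans)
  qed
  moreover have "z \<le> Max (set xs)" if "z \<in> set zs" for z
  proof -
    have "z \<in> set xs"
      using that by (subst split) simp
    then show ?thesis
      by simp
  qed
  ultimately have "stack_sort (ys @ Max (set xs) # zs) = stack_sort ys @ stack_sort zs @ [Max (set xs)]"
    by (intro stack_sort_split_at_max) auto
  with split show ?thesis
    by simp
qed

lemma stack_sort_append_increasing: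
  assumes "sorted_wrt (<) ys" and "\<forall>x \<in> set xs. \<forall>y \<in> set ys. x < y"
  shows "stack_sort (xs @ ys) = stack_sort xs @ ys"
  using assms
proof (induction ys rule: rev_induct)
  case (snoc y ys)
  then have "stack_sort ((xs @ ys) @ y # []) = stack_sort (xs @ ys) @ stack_sort [] @ [y]"
    by (intro stack_sort_split_at_max) (auto simp: sorted_wrt_append)
  with snoc show ?case
    by (simp add: sorted_wrt_append)
qed simp

section \<open>The iterates of a word ending in its maximum and 1\<close>

text \<open>
  The words \<open>B m 1 (m+1) \<dots> n\<close> met during the sorting. Here \<open>A = B m\<close>; exempting \<open>m = 1\<close> from
  the condition on the last entry of \<open>A\<close> includes the identity as the final stage, where \<open>A\<close> is empty.
\<close>

definition stage :: "nat \<Rightarrow> nat \<Rightarrow> nat list set" where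
  "stage n m = {A @ 1 # [Suc m..<Suc n] | A.
     A \<in> permutations_of_set {2..m} \<and> (m \<noteq> 1 \<longrightarrow> last A = m)}"

lemma stack_sort_stage:
  assumes "q \<in> stage n (Suc m)" and "1 \<le> m" and "m < n"
  shows "stack_sort q \<in> stage n m"
proof -
  obtain A where q: "q = A @ 1 # [Suc (Suc m)..<Suc n]"
    and A: "set A = {2..Suc m}" "distinct A" "last A = Suc m"
    using assms by (auto simp: stage_def permutations_of_set_def)
  have "A \<noteq> []"
    using A(1) assms(2) by auto
  then obtain B where AB: "A = B @ [Suc m]"
    using A(3) by (metis append_butlast_last_id)
  have "insert (Suc m) (set B) = {2..Suc m}" and "Suc m \<notin> set B"
    using A(1,2) by (simp_all add: AB)
  moreover have "{2..Suc m} - {Suc m} = {2..m}"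
    by (simp add: set_eq_iff) presburger
  ultimately have B: "set B = {2..m}"
    by blast
  have "distinct B"
    using A(2) by (simp add: AB)
  have "stack_sort [1::nat] = [1]"
    by (simp add: stack_sort_def)
  then have "stack_sort (B @ Suc m # [1]) = stack_sort B @ [1, Suc m]"
    using B by (subst stack_sort_split_at_max) auto
  moreover have "stack_sort ((B @ [Suc m, 1]) @ [Suc (Suc m)..<Suc n])
      = stack_sort (B @ [Suc m, 1]) @ [Suc (Suc m)..<Suc n]"
    using B by (intro stack_sort_append_increasing) (auto simp del: upt_Suc)
  ultimately have "stack_sort q = stack_sort B @ 1 # [Suc m..<Suc n]"
    using assms(3) by (simp add: q AB upt_conv_Cons del: upt_Suc)
  moreover have "last (stack_sort B) = m" if "m \<noteq> 1"
  proof -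
    have "B \<noteq> []"
      using B that assms(2) by auto
    moreover have "Max {2..m} = m"
      using that assms(2) by (intro Max_eqI) auto
    ultimately show ?thesis
      using B \<open>distinct B\<close> by (simp add: last_stack_sort)
  qed
  ultimately show ?thesis
    unfolding stage_def permutations_of_set_def using B \<open>distinct B\<close>
    by (intro CollectI exI[of _ "stack_sort B"]) simp
qed

lemma stage_1: "stage n 1 = {1 # [2..<Suc n]}"
  by (auto simp: stage_def numeral_2_eq_2)

lemma length_prefix_of_stage:
  assumes "A \<in> permutations_of_set {2..m}"
  shows "length A = m - 1"
  using length_finite_permutations_of_set[OF assms] by simp

lemma stage_nth_fixed:
  assumes "q \<in> stage n m" and "1 \<le> m" and "m \<le> i" and "i < n"
  shows "q ! i = Suc i"
proof -
  obtain A where q: "q = A @ 1 # [Suc m..<Suc n]" and "length A = m - 1"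
    using assms(1) length_prefix_of_stage by (auto simp: stage_def)
  then have "q ! i = [Suc m..<Suc n] ! (i - m)"
    using assms(2,3) by (auto simp: nth_append simp del: upt_Suc)
  with assms(3,4) show ?thesis
    by (simp del: upt_Suc)
qed

lemma stage_nth_one:
  assumes "q \<in> stage n (Suc m)"
  shows "q ! m = 1"
proof -
  obtain A where "q = A @ 1 # [Suc (Suc m)..<Suc n]" and "length A = m"
    using assms length_prefix_of_stage[of _ "Suc m"] by (auto simp: stage_def)
  then show ?thesis
    by (simp add: nth_append)
qed

lemma stack_iterates_unfold:
  "stack_iterates q = insert q (stack_iterates (stack_sort q))"
proof -
  have "stack_iterates q = range (\<lambda>k. (stack_sort ^^ k) q)" for q :: "'a list"
    by (auto simp: stack_iterates_def)
  moreover have "range (\<lambda>k. (stack_sort ^^ k) q)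
      = insert q (range (\<lambda>k. (stack_sort ^^ Suc k) q))"
    by (subst UNIV_nat_eq) (auto simp: image_image)
  ultimately show ?thesis
    by (simp add: funpow_swap1)
qed

lemma stack_iterates_fixpoint:
  assumes "stack_sort q = q"
  shows "stack_iterates q = {q}"
proof -
  have "(stack_sort ^^ k) q = q" for k
    by (induction k) (simp_all add: assms)
  then show ?thesis
    by (auto simp: stack_iterates_def)
qed

section \<open>Affine independence of the iterates\<close>

lemma affine_independent_insert_off_hyperplane:
  fixes S :: "(real ^ 'n) set"
  assumes "\<not> affine_dependent S" and "\<And>x. x \<in> S \<Longrightarrow> x $ i = c" and "a $ i \<noteq> c"
  shows "\<not> affine_dependent (insert a S)"
proof -
  have "affine {x :: real ^ 'n. x $ i = c}"
    by (auto simp: affine_def simp flip: distrib_right)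
  then have "affine hull S \<subseteq> {x. x $ i = c}"
    using assms(2) by (intro hull_minimal) auto
  with assms(1,3) show ?thesis
    by (intro affine_independent_insert) auto
qed

text \<open>
  The last conclusion places the iterates of a word of stage \<open>m\<close> in the hyperplanes that a point
  of stage \<open>m + 1\<close> has to avoid, which makes the induction work.
\<close>

lemma stage_iterates_affinely_independent:
  fixes idx :: "'n::finite \<Rightarrow> nat"
  assumes idx: "bij_betw idx (UNIV :: 'n set) {0..<n}"
    and "1 \<le> m" and "m \<le> n" and "q \<in> stage n m"
  defines "S \<equiv> \<lambda>q. perm_point idx ` stack_iterates q"
  shows "\<not> affine_dependent (S q) \<and> finite (S q) \<and> card (S q) = m
    \<and> (\<forall>x \<in> S q. \<forall>i. m \<le> idx i \<longrightarrow> x $ i = real (Suc (idx i)))"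
proof -
  have idx_less: "idx i < n" for i
    using bij_betwE[OF idx] by auto
  have fixed: "perm_point idx q $ i = real (Suc (idx i))"
    if "q \<in> stage n m" "1 \<le> m" "m \<le> idx i" for q m i
    using stage_nth_fixed[OF that idx_less] by (simp add: perm_point_def)
  show ?thesis
    using assms(2-4)
  proof (induction m arbitrary: q rule: nat_induct_at_least)
    case base
    then have q: "q = [] @ 1 # [2..<Suc n]"
      using stage_1[of n] by (simp del: upt_Suc)
    have "stack_sort q = stack_sort [] @ 1 # [2..<Suc n]"
      unfolding q by (intro stack_sort_append_increasing) (auto simp del: upt_Suc)
    then have "stack_sort q = q"
      by (simp add: q del: upt_Suc)
    then have "S q = {perm_point idx q}"
      by (simp add: S_def stack_iterates_fixpoint)
    with fixed base show ?case
      by simp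
  next
    case (Suc m)
    define q' where "q' = stack_sort q"
    have "q' \<in> stage n m"
      using Suc by (simp add: q'_def stack_sort_stage)
    with Suc have IH: "\<not> affine_dependent (S q')" "finite (S q')" "card (S q') = m"
      "\<And>x i. x \<in> S q' \<Longrightarrow> m \<le> idx i \<Longrightarrow> x $ i = real (Suc (idx i))"
      by auto
    have S: "S q = insert (perm_point idx q) (S q')"
      unfolding S_def q'_def by (subst stack_iterates_unfold) simp
    (* With positions counted from 0, the entry 1 of q is at position m; there every later iterate
       has the entry m + 1. *)
    obtain j where j: "idx j = m"
      using idx Suc.prems by (metis Suc_le_lessD atLeastLessThan_iff bij_betw_iff_bijections le0)
    have off: "perm_point idx q $ j \<noteq> real (Suc m)"
      using stage_nth_one[OF Suc.prems(2)] Suc.hyps by (simp add: perm_point_def j)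
    have on: "x $ j = real (Suc m)" if "x \<in> S q'" for x
      using IH(4)[OF that, of j] j by simp
    have "\<not> affine_dependent (S q)"
      unfolding S using IH(1) on off by (rule affine_independent_insert_off_hyperplane)
    moreover have "perm_point idx q \<notin> S q'"
      using on off by auto
    ultimately show ?case
      using IH fixed[OF Suc.prems(2)] by (auto simp: S)
  qed
qed

lemma Ln1_perms_stage:
  assumes "n \<ge> 2" and "p \<in> Ln1_perms n"
  shows "p \<in> stage n n"
proof -
  obtain L where L: "p = L @ [n, 1]" "set L = {2..n - 1}" "distinct L"
    using assms(2) by (auto simp: Ln1_perms_def permutations_of_set_def)
  have "p = (L @ [n]) @ 1 # [Suc n..<Suc n]"
    using L by simp
  moreover have "set (L @ [n]) = {2..n}" "distinct (L @ [n])"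
    using L assms(1) by auto
  ultimately show ?thesis
    unfolding stage_def permutations_of_set_def by force
qed

theorem proposition4p2:
  fixes n :: nat and p :: "nat list" and idx :: "'n::finite \<Rightarrow> nat"
  assumes "n \<ge> 2"
    and "bij_betw idx (UNIV :: 'n set) {0..<n}"
    and "p \<in> Ln1_perms n"
  shows "(int n - 1) simplex (convex hull (perm_point idx ` stack_iterates p))"
proof -
  have "\<not> affine_dependent (perm_point idx ` stack_iterates p)"
    and "card (perm_point idx ` stack_iterates p) = n"
    using stage_iterates_affinely_independent[OF assms(2) _ order_refl Ln1_perms_stage] assms
    by auto
  then show ?thesis
    unfolding simplex_def by auto
qed

end
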